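(* Let $R$ be any ring and let $n\ge 1$ be an integer. Then $R$ is a $\sqrt{J}$-clean ring if and only if $D_n(R)$ is a $\sqrt{J}$-clean ring.
   Context: Rings are associative with identity $1\neq 0$ (not necessarily commutative). $J(R)$ is the Jacobson radical of $R$, and $\sqrt{J(R)}=\{z\in R : z^k\in J(R)\text{ for some } k\ge 1\}$. A ring $R$ is $\sqrt{J}$-clean if every $x\in R$ can be written as $x=e+z$ with $e$ an idempotent of $R$ and $z\in\sqrt{J(R)}$. $D_n(R)$ is the ring of all $n\times n$ upper triangular matrices over $R$ whose diagonal entries are all equal. *)

theory Defs
  imports "HOL-Algebra.Ring" "HOL-Algebra.AbelCoset" "Jordan_Normal_Form.Matrix"
begin

text \<open>The locale \<open>ring\<close> of HOL-Algebra is not necessarily commutative but admits the zero ring.\<close>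

locale nontrivial_ring = ring R for R (structure) +
  assumes one_not_zero: "\<one> \<noteq> \<zero>"

text \<open>The locales \<open>ideal\<close> and \<open>maximalideal\<close> of HOL-Algebra are two-sided; the Jacobson radical
  of a noncommutative ring needs the one-sided versions.\<close>

locale left_ideal = additive_subgroup I R + ring R for I and R (structure) +
  assumes I_l_closed: "\<lbrakk>a \<in> I; x \<in> carrier R\<rbrakk> \<Longrightarrow> x \<otimes> a \<in> I"

locale maximal_left_ideal = left_ideal I R for I and R (structure) +
  assumes I_notcarr: "carrier R \<noteq> I"
    and I_maximal: "\<lbrakk>left_ideal K R; I \<subseteq> K; K \<subseteq> carrier R\<rbrakk> \<Longrightarrow> K = I \<or> K = carrier R"

definition jacobson_radical :: "('a, 'm) ring_scheme \<Rightarrow> 'a set" where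
  "jacobson_radical R = {x \<in> carrier R. \<forall>M. maximal_left_ideal M R \<longrightarrow> x \<in> M}"

definition sqrt_jacobson :: "('a, 'm) ring_scheme \<Rightarrow> 'a set" where
  "sqrt_jacobson R = {z \<in> carrier R. \<exists>k::nat. k \<ge> 1 \<and> z [^]\<^bsub>R\<^esub> k \<in> jacobson_radical R}"

definition idempotents :: "('a, 'm) ring_scheme \<Rightarrow> 'a set" where
  "idempotents R = {e \<in> carrier R. e \<otimes>\<^bsub>R\<^esub> e = e}"

locale sqrtJ_clean_ring = nontrivial_ring R for R (structure) +
  assumes sqrtJ_clean:
    "x \<in> carrier R \<Longrightarrow> \<exists>e \<in> idempotents R. \<exists>z \<in> sqrt_jacobson R. x = e \<oplus> z"

text \<open>The matrix operations of \<open>Jordan_Normal_Form\<close> are defined for type-class rings only, so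
  they are restated for a ring given by a carrier. Indices run from \<open>0\<close> to \<open>n - 1\<close>.\<close>

definition diag_const_upper_ring :: "nat \<Rightarrow> ('a, 'm) ring_scheme \<Rightarrow> 'a mat ring" where
  "diag_const_upper_ring n R = \<lparr>
    carrier = {A \<in> carrier_mat n n.
      (\<forall>i<n. \<forall>j<n. A $$ (i, j) \<in> carrier R) \<and>
      (\<forall>i<n. \<forall>j<i. A $$ (i, j) = \<zero>\<^bsub>R\<^esub>) \<and>
      (\<forall>i<n. \<forall>j<n. A $$ (i, i) = A $$ (j, j))},
    monoid.mult = (\<lambda>A B. mat n n (\<lambda>(i, j). \<Oplus>\<^bsub>R\<^esub>k\<in>{..<n}. A $$ (i, k) \<otimes>\<^bsub>R\<^esub> B $$ (k, j))),
    one = mat n n (\<lambda>(i, j). if i = j then \<one>\<^bsub>R\<^esub> else \<zero>\<^bsub>R\<^esub>),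
    zero = mat n n (\<lambda>(i, j). \<zero>\<^bsub>R\<^esub>),
    add = (\<lambda>A B. mat n n (\<lambda>(i, j). A $$ (i, j) \<oplus>\<^bsub>R\<^esub> B $$ (i, j)))\<rparr>"

end

theory Submission
  imports Defs "HOL-Algebra.RingHom" "Jordan_Normal_Form.Missing_Ring"
begin

text \<open>Reading off the common diagonal entry is a surjective ring homomorphism
  \<open>D\<^sub>n(R) \<rightarrow> R\<close>. Its kernel consists of the strictly upper triangular matrices, which are
  nilpotent, and it is split by the embedding of \<open>R\<close> as scalar matrices. The equivalence
  holds for every such map \<open>h\<close>; in the general form it is written \<open>h : R \<rightarrow> S\<close>, so there the source
  \<open>R\<close> takes the place of \<open>D\<^sub>n(R)\<close>.

  An element all of whose left multiples are nilpotent lies in every maximal left ideal. So maximal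
  left ideals of \<open>R\<close> contain the kernel of \<open>h\<close>, an ideal of nilpotent elements, and correspond to
  those of \<open>S\<close>; consequently membership in the Jacobson radical, and therefore in \<open>\<surd>J\<close>, can be
  tested on the image under \<open>h\<close> (\<open>sqrt_jacobson_iff\<close>). A decomposition \<open>x = e + z\<close> in \<open>R\<close> is then
  mapped by \<open>h\<close> to one in \<open>S\<close>. Conversely, given a decomposition \<open>h x = e + z\<close> in \<open>S\<close>, lift \<open>e\<close> to
  the idempotent \<open>s e\<close> by means of the splitting \<open>s\<close>; the difference \<open>x - s e\<close> maps to \<open>z\<close>, hence
  belongs to \<open>\<surd>J(R)\<close>.\<close>

section \<open>Left ideals and nilpotent elements\<close>

context ring
begin

lemma left_idealI:
  assumes sub: "I \<subseteq> carrier R" and zero: "\<zero> \<in> I"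
    and add: "\<And>a b. \<lbrakk>a \<in> I; b \<in> I\<rbrakk> \<Longrightarrow> a \<oplus> b \<in> I"
    and mult: "\<And>a x. \<lbrakk>a \<in> I; x \<in> carrier R\<rbrakk> \<Longrightarrow> x \<otimes> a \<in> I"
  shows "left_ideal I R"
proof -
  have minus: "\<ominus> a \<in> I" if "a \<in> I" for a
    using mult[OF that, of "\<ominus> \<one>"] that sub by (auto simp: l_minus)
  have "subgroup I (add_monoid R)"
  proof (rule subgroup.intro)
    show "inv\<^bsub>add_monoid R\<^esub> x \<in> I" if "x \<in> I" for x
      using minus[OF that] by (simp add: a_inv_def)
  qed (use sub zero add in auto)
  then show ?thesis
    by (intro left_ideal.intro additive_subgroupI left_ideal_axioms.intro ring_axioms mult)
qed

lemma left_ideal_eq_carrier: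
  assumes "left_ideal I R" "\<one> \<in> I"
  shows "I = carrier R"
proof -
  interpret left_ideal I R by fact
  show ?thesis
    using I_l_closed[OF assms(2)] a_subset by force
qed

lemma maximal_left_idealI:
  assumes "left_ideal M R" "\<one> \<notin> M"
    and "\<And>K x. \<lbrakk>left_ideal K R; M \<subseteq> K; x \<in> K; x \<notin> M\<rbrakk> \<Longrightarrow> \<one> \<in> K"
  shows "maximal_left_ideal M R"
proof (intro maximal_left_ideal.intro maximal_left_ideal_axioms.intro assms(1))
  show "carrier R \<noteq> M" using assms(2) by auto
next
  fix K assume K: "left_ideal K R" "M \<subseteq> K"
  then show "K = M \<or> K = carrier R"
    using assms(3)[OF K] left_ideal_eq_carrier[OF K(1)] by blast
qed

lemma one_minus_nilpotent_left_invertible: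
  assumes y: "y \<in> carrier R" and nil: "y [^] (k::nat) = \<zero>"
  shows "\<exists>u\<in>carrier R. u \<otimes> (\<one> \<ominus> y) = \<one>"
proof -
  \<comment> \<open>The witness is the partial geometric series, which telescopes.\<close>
  have "\<exists>u\<in>carrier R. u \<otimes> (\<one> \<ominus> y) = \<one> \<ominus> y [^] m" for m :: nat
  proof (induction m)
    case 0
    show ?case using y by (intro bexI[of _ \<zero>]) (auto simp: minus_eq r_neg)
  next
    case (Suc m)
    then obtain u where u: "u \<in> carrier R" "u \<otimes> (\<one> \<ominus> y) = \<one> \<ominus> y [^] m" by blast
    define p where "p = y [^] m"
    have p: "p \<in> carrier R" using y by (simp add: p_def)
    have "(u \<oplus> p) \<otimes> (\<one> \<ominus> y) = (\<one> \<ominus> p) \<oplus> p \<otimes> (\<one> \<ominus> y)"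
      using u y p by (simp add: l_distr p_def)
    also have "\<dots> = \<one> \<ominus> p \<otimes> y"
      using y p by (simp add: minus_eq r_distr r_minus a_assoc r_neg2 r_neg1)
    finally show ?case using u p by (intro bexI[of _ "u \<oplus> p"]) (auto simp: p_def)
  qed
  from this[of k] show ?thesis using nil by (simp add: minus_eq)
qed

text \<open>If \<open>a\<close> were outside the maximal left ideal \<open>M\<close>, then \<open>M + R a\<close> would contain \<open>1\<close>, and \<open>M\<close> would
  contain some \<open>1 - s a\<close> with \<open>s a\<close> nilpotent; but such an element has a left inverse.\<close>

lemma nil_left_multiples_in_maximal_left_ideal:
  assumes M: "maximal_left_ideal M R" and a: "a \<in> carrier R"
    and nil: "\<And>s. s \<in> carrier R \<Longrightarrow> \<exists>k::nat. (s \<otimes> a) [^] k = \<zero>"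
  shows "a \<in> M"
proof (rule ccontr)
  assume aM: "a \<notin> M"
  interpret M: maximal_left_ideal M R by fact
  define K where "K = {m \<oplus> s \<otimes> a |m s. m \<in> M \<and> s \<in> carrier R}"
  have KI: "m \<oplus> s \<otimes> a \<in> K" if "m \<in> M" "s \<in> carrier R" for m s
    using that by (auto simp: K_def)
  have Msub: "m \<in> carrier R" if "m \<in> M" for m
    using that M.a_subset by auto
  have K: "left_ideal K R"
  proof (rule left_idealI)
    show "K \<subseteq> carrier R" using Msub a by (auto simp: K_def)
    show "\<zero> \<in> K" using KI[OF M.zero_closed zero_closed] a by simp
  next
    fix b c assume "b \<in> K" "c \<in> K"
    then obtain m s m' s' where *: "b = m \<oplus> s \<otimes> a" "c = m' \<oplus> s' \<otimes> a"
      "m \<in> M" "s \<in> carrier R" "m' \<in> M" "s' \<in> carrier R" by (auto simp: K_def)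
    have "b \<oplus> c = (m \<oplus> m') \<oplus> (s \<oplus> s') \<otimes> a"
      using * a Msub by (simp add: l_distr a_ac)
    then show "b \<oplus> c \<in> K" using KI * by simp
  next
    fix b x assume "b \<in> K" and x: "x \<in> carrier R"
    then obtain m s where *: "b = m \<oplus> s \<otimes> a" "m \<in> M" "s \<in> carrier R"
      by (auto simp: K_def)
    have "x \<otimes> b = x \<otimes> m \<oplus> (x \<otimes> s) \<otimes> a"
      using * x a Msub by (simp add: r_distr m_assoc)
    then show "x \<otimes> b \<in> K" using KI M.I_l_closed * x by simp
  qed
  interpret K: left_ideal K R by fact
  have "M \<subseteq> K" using KI[OF _ zero_closed] a Msub by fastforce
  moreover have "a \<in> K" using KI[OF M.zero_closed one_closed] a by simp
  ultimately have "K = carrier R" using M.I_maximal[OF K] K.a_subset aM by blast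
  then have "\<one> \<in> K" by simp
  then obtain m s where ms: "\<one> = m \<oplus> s \<otimes> a" "m \<in> M" "s \<in> carrier R"
    unfolding K_def by blast
  have "m = (m \<oplus> s \<otimes> a) \<ominus> s \<otimes> a"
    using ms(2,3) a Msub by (simp add: minus_eq a_assoc r_neg)
  then have "m = \<one> \<ominus> s \<otimes> a" by (simp only: ms(1))
  then obtain u where "u \<in> carrier R" "u \<otimes> m = \<one>"
    using nil[OF ms(3)] one_minus_nilpotent_left_invertible[of "s \<otimes> a"] ms(3) a by auto
  then have "\<one> \<in> M" using M.I_l_closed[OF ms(2)] by metis
  then show False
    using left_ideal_eq_carrier[OF M.left_ideal_axioms] M.I_notcarr by simp
qed

end

section \<open>Surjective homomorphisms with nil kernel\<close>

locale nil_epimorphism = ring_hom_ring +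
  assumes surj: "y \<in> carrier S \<Longrightarrow> \<exists>x\<in>carrier R. h x = y"
    and nil_kernel: "\<lbrakk>x \<in> carrier R; h x = \<zero>\<^bsub>S\<^esub>\<rbrakk> \<Longrightarrow> \<exists>k::nat. x [^]\<^bsub>R\<^esub> k = \<zero>\<^bsub>R\<^esub>"
begin

lemma kernel_in_maximal_left_ideal:
  assumes "maximal_left_ideal M R" "a \<in> carrier R" "h a = \<zero>\<^bsub>S\<^esub>"
  shows "a \<in> M"
  by (rule R.nil_left_multiples_in_maximal_left_ideal[OF assms(1,2)]) (use assms nil_kernel in auto)

lemma mem_maximal_left_ideal_if_same_image:
  assumes M: "maximal_left_ideal M R" and "b \<in> M" "a \<in> carrier R" "h a = h b"
  shows "a \<in> M"
proof -
  interpret M: maximal_left_ideal M R by fact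
  have b: "b \<in> carrier R" using assms M.a_subset by auto
  have "a \<oplus>\<^bsub>R\<^esub> \<ominus>\<^bsub>R\<^esub> b \<in> M"
    using assms b by (intro kernel_in_maximal_left_ideal[OF M]) (auto simp: S.r_neg)
  then have "(a \<oplus>\<^bsub>R\<^esub> \<ominus>\<^bsub>R\<^esub> b) \<oplus>\<^bsub>R\<^esub> b \<in> M" using assms by simp
  then show ?thesis using assms b by (simp add: R.a_assoc R.l_neg)
qed

lemma left_ideal_vimage:
  assumes "left_ideal K S"
  shows "left_ideal {a \<in> carrier R. h a \<in> K} R"
proof -
  interpret K: left_ideal K S by fact
  show ?thesis by (rule R.left_idealI) (auto intro: K.I_l_closed)
qed

lemma left_ideal_image:
  assumes "left_ideal K R"
  shows "left_ideal (h ` K) S"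
proof -
  interpret K: left_ideal K R by fact
  have Ksub: "a \<in> carrier R" if "a \<in> K" for a using that K.a_subset by auto
  show ?thesis
  proof (rule S.left_idealI)
    show "h ` K \<subseteq> carrier S" using Ksub by auto
    show "\<zero>\<^bsub>S\<^esub> \<in> h ` K" using K.zero_closed by (intro image_eqI[of _ _ "\<zero>\<^bsub>R\<^esub>"]) auto
  next
    fix a b assume "a \<in> h ` K" "b \<in> h ` K"
    then obtain a' b' where "a = h a'" "b = h b'" "a' \<in> K" "b' \<in> K" by auto
    then show "a \<oplus>\<^bsub>S\<^esub> b \<in> h ` K" using Ksub by (auto intro!: image_eqI[of _ _ "a' \<oplus>\<^bsub>R\<^esub> b'"])
  next
    fix a y assume "a \<in> h ` K" "y \<in> carrier S"
    then obtain a' x where "a = h a'" "y = h x" "a' \<in> K" "x \<in> carrier R"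
      using surj by blast
    then show "y \<otimes>\<^bsub>S\<^esub> a \<in> h ` K"
      using Ksub K.I_l_closed by (auto intro!: image_eqI[of _ _ "x \<otimes>\<^bsub>R\<^esub> a'"])
  qed
qed

lemma maximal_left_ideal_vimage:
  assumes M: "maximal_left_ideal M S"
  shows "maximal_left_ideal {a \<in> carrier R. h a \<in> M} R"
proof -
  interpret M: maximal_left_ideal M S by fact
  have one: "\<one>\<^bsub>S\<^esub> \<notin> M"
    using S.left_ideal_eq_carrier[OF M.left_ideal_axioms] M.I_notcarr by auto
  show ?thesis
  proof (rule R.maximal_left_idealI[OF left_ideal_vimage[OF M.left_ideal_axioms]])
    fix K x
    assume K: "left_ideal K R" and sub: "{a \<in> carrier R. h a \<in> M} \<subseteq> K"
      and x: "x \<in> K" "x \<notin> {a \<in> carrier R. h a \<in> M}"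
    interpret K: left_ideal K R by fact
    interpret hK: left_ideal "h ` K" S by (rule left_ideal_image[OF K])
    have "M \<subseteq> h ` K" using sub surj M.a_subset by blast
    moreover have "h x \<in> h ` K" "h x \<notin> M" using x K.a_subset by auto
    ultimately have "h ` K = carrier S"
      using M.I_maximal[OF hK.left_ideal_axioms] hK.a_subset by blast
    then obtain b where b: "b \<in> K" "h b = \<one>\<^bsub>S\<^esub>" using S.one_closed by (metis imageE)
    have bR: "b \<in> carrier R" using b K.a_subset by auto
    \<comment> \<open>\<open>1 - b\<close> lies in the kernel, which the preimage of \<open>M\<close> contains.\<close>
    have "\<one>\<^bsub>R\<^esub> \<oplus>\<^bsub>R\<^esub> \<ominus>\<^bsub>R\<^esub> b \<in> K"
      using b bR sub by (auto simp: S.r_neg)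
    then have "(\<one>\<^bsub>R\<^esub> \<oplus>\<^bsub>R\<^esub> \<ominus>\<^bsub>R\<^esub> b) \<oplus>\<^bsub>R\<^esub> b \<in> K" using b by simp
    then show "\<one>\<^bsub>R\<^esub> \<in> K" using bR by (simp add: R.a_assoc R.l_neg)
  qed (use one in simp)
qed

lemma maximal_left_ideal_image:
  assumes M: "maximal_left_ideal M R"
  shows "maximal_left_ideal (h ` M) S"
proof -
  interpret M: maximal_left_ideal M R by fact
  have one: "\<one>\<^bsub>R\<^esub> \<notin> M"
    using R.left_ideal_eq_carrier[OF M.left_ideal_axioms] M.I_notcarr by auto
  show ?thesis
  proof (rule S.maximal_left_idealI[OF left_ideal_image[OF M.left_ideal_axioms]])
    show "\<one>\<^bsub>S\<^esub> \<notin> h ` M"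
    proof
      assume "\<one>\<^bsub>S\<^esub> \<in> h ` M"
      then obtain b where b: "b \<in> M" "h b = \<one>\<^bsub>S\<^esub>" by auto
      have "\<one>\<^bsub>R\<^esub> \<in> M"
        by (rule mem_maximal_left_ideal_if_same_image[OF M b(1)]) (simp_all add: b(2))
      with one show False ..
    qed
  next
    fix K y
    assume K: "left_ideal K S" and sub: "h ` M \<subseteq> K" and y: "y \<in> K" "y \<notin> h ` M"
    interpret K: left_ideal K S by fact
    let ?L = "{a \<in> carrier R. h a \<in> K}"
    obtain x where x: "x \<in> carrier R" "h x = y" using y K.a_subset surj by blast
    have "x \<in> ?L" "x \<notin> M" using x y by auto
    moreover have "M \<subseteq> ?L" using sub M.a_subset by auto
    ultimately have "?L = carrier R"
      using M.I_maximal[OF left_ideal_vimage[OF K]] by blast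
    then have "\<one>\<^bsub>R\<^esub> \<in> ?L" by simp
    then show "\<one>\<^bsub>S\<^esub> \<in> K" by simp
  qed
qed

text \<open>Images and preimages under \<open>h\<close> carry maximal left ideals to maximal left ideals; since each
  maximal left ideal of \<open>R\<close> is a union of fibres of \<open>h\<close>, membership of \<open>a\<close> depends on \<open>h a\<close> only.\<close>

lemma jacobson_radical_iff:
  assumes a: "a \<in> carrier R"
  shows "a \<in> jacobson_radical R \<longleftrightarrow> h a \<in> jacobson_radical S"
proof
  assume "a \<in> jacobson_radical R"
  then show "h a \<in> jacobson_radical S"
    using maximal_left_ideal_vimage a by (fastforce simp: jacobson_radical_def)
next
  assume ha: "h a \<in> jacobson_radical S"
  have "a \<in> M" if M: "maximal_left_ideal M R" for M
  proof -
    have "h a \<in> h ` M" using ha maximal_left_ideal_image[OF M] by (simp add: jacobson_radical_def)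
    then show ?thesis using mem_maximal_left_ideal_if_same_image[OF M _ a] by auto
  qed
  then show "a \<in> jacobson_radical R" using a by (simp add: jacobson_radical_def)
qed

lemma hom_nat_pow:
  assumes "a \<in> carrier R"
  shows "h (a [^]\<^bsub>R\<^esub> (k::nat)) = h a [^]\<^bsub>S\<^esub> k"
  using assms by (induction k) auto

lemma sqrt_jacobson_iff:
  assumes "a \<in> carrier R"
  shows "a \<in> sqrt_jacobson R \<longleftrightarrow> h a \<in> sqrt_jacobson S"
  using assms by (simp add: sqrt_jacobson_def jacobson_radical_iff hom_nat_pow)

lemma sqrtJ_clean_image:
  assumes "sqrtJ_clean_ring R" and S: "nontrivial_ring S"
  shows "sqrtJ_clean_ring S"
proof (intro sqrtJ_clean_ring.intro sqrtJ_clean_ring_axioms.intro S)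
  fix y assume "y \<in> carrier S"
  then obtain x where x: "x \<in> carrier R" "h x = y" using surj by blast
  obtain e z where ez: "e \<in> idempotents R" "z \<in> sqrt_jacobson R" "x = e \<oplus>\<^bsub>R\<^esub> z"
    using sqrtJ_clean_ring.sqrtJ_clean[OF assms(1) x(1)] by auto
  then have car: "e \<in> carrier R" "z \<in> carrier R"
    by (auto simp: idempotents_def sqrt_jacobson_def)
  have "h e \<in> idempotents S"
    using ez(1) car hom_mult[of e e] by (simp add: idempotents_def)
  moreover have "h z \<in> sqrt_jacobson S" using ez(2) car sqrt_jacobson_iff by simp
  moreover have "y = h e \<oplus>\<^bsub>S\<^esub> h z" using ez(3) x(2) car by simp
  ultimately show "\<exists>e\<in>idempotents S. \<exists>z\<in>sqrt_jacobson S. y = e \<oplus>\<^bsub>S\<^esub> z" by blast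
qed

text \<open>The splitting serves only to lift idempotents of \<open>S\<close> to idempotents of \<open>R\<close>, so it may be any
  multiplicative section.\<close>

lemma sqrtJ_clean_lift:
  assumes "sqrtJ_clean_ring S" and R: "nontrivial_ring R"
    and s_closed: "\<And>r. r \<in> carrier S \<Longrightarrow> s r \<in> carrier R"
    and s_mult: "\<And>r t. \<lbrakk>r \<in> carrier S; t \<in> carrier S\<rbrakk> \<Longrightarrow> s (r \<otimes>\<^bsub>S\<^esub> t) = s r \<otimes>\<^bsub>R\<^esub> s t"
    and section_s: "\<And>r. r \<in> carrier S \<Longrightarrow> h (s r) = r"
  shows "sqrtJ_clean_ring R"
proof (intro sqrtJ_clean_ring.intro sqrtJ_clean_ring_axioms.intro R)
  fix x assume x: "x \<in> carrier R"
  then obtain e z where ez: "e \<in> idempotents S" "z \<in> sqrt_jacobson S" "h x = e \<oplus>\<^bsub>S\<^esub> z"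
    using sqrtJ_clean_ring.sqrtJ_clean[OF assms(1), of "h x"] by auto
  then have car: "e \<in> carrier S" "z \<in> carrier S"
    by (auto simp: idempotents_def sqrt_jacobson_def)
  define w where "w = \<ominus>\<^bsub>R\<^esub> s e \<oplus>\<^bsub>R\<^esub> x"
  have w: "w \<in> carrier R" using x car s_closed by (simp add: w_def)
  have "h w = z"
    using x car s_closed section_s ez(3) by (simp add: w_def S.r_neg1)
  then have "w \<in> sqrt_jacobson R" using w ez(2) sqrt_jacobson_iff by simp
  moreover have "s e \<in> idempotents R"
    using ez(1) s_closed s_mult[of e e] by (simp add: idempotents_def)
  moreover have "x = s e \<oplus>\<^bsub>R\<^esub> w" using x car s_closed by (simp add: w_def R.r_neg2)
  ultimately show "\<exists>e\<in>idempotents R. \<exists>z\<in>sqrt_jacobson R. x = e \<oplus>\<^bsub>R\<^esub> z" by blast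
qed

end

section \<open>Upper triangular matrices with constant diagonal\<close>

context ring
begin

lemma finsum_eq_single:
  assumes "finite A" "i \<in> A" "f i \<in> carrier R" "\<And>k. \<lbrakk>k \<in> A; k \<noteq> i\<rbrakk> \<Longrightarrow> f k = \<zero>"
  shows "(\<Oplus>k\<in>A. f k) = f i"
proof -
  have f: "f \<in> A \<rightarrow> carrier R" by (intro Pi_I) (metis assms(3,4) zero_closed)
  have "(\<Oplus>k\<in>A. f k) = (\<Oplus>k\<in>A. if i = k then f k else \<zero>)"
    using f assms(4) by (intro finsum_cong') auto
  then show ?thesis using finsum_singleton[OF assms(2,1) f] by simp
qed

abbreviation "D n \<equiv> diag_const_upper_ring n R"

lemma D_carrier_mat [simp]:
  "A \<otimes>\<^bsub>D n\<^esub> B \<in> carrier_mat n n" "A \<oplus>\<^bsub>D n\<^esub> B \<in> carrier_mat n n"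
  "\<one>\<^bsub>D n\<^esub> \<in> carrier_mat n n" "\<zero>\<^bsub>D n\<^esub> \<in> carrier_mat n n"
  by (simp_all add: diag_const_upper_ring_def)

lemma D_index [simp]:
  assumes "i < n" "j < n"
  shows "(A \<otimes>\<^bsub>D n\<^esub> B) $$ (i, j) = (\<Oplus>k\<in>{..<n}. A $$ (i, k) \<otimes> B $$ (k, j))"
    and "(A \<oplus>\<^bsub>D n\<^esub> B) $$ (i, j) = A $$ (i, j) \<oplus> B $$ (i, j)"
    and "\<one>\<^bsub>D n\<^esub> $$ (i, j) = (if i = j then \<one> else \<zero>)"
    and "\<zero>\<^bsub>D n\<^esub> $$ (i, j) = \<zero>"
  using assms by (simp_all add: diag_const_upper_ring_def)

lemma D_carrier_iff:
  "A \<in> carrier (D n) \<longleftrightarrow> A \<in> carrier_mat n n \<and>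
    (\<forall>i<n. \<forall>j<n. A $$ (i, j) \<in> carrier R) \<and>
    (\<forall>i<n. \<forall>j<i. A $$ (i, j) = \<zero>) \<and>
    (\<forall>i<n. \<forall>j<n. A $$ (i, i) = A $$ (j, j))"
  by (simp add: diag_const_upper_ring_def)

lemma D_carrierI:
  assumes "A \<in> carrier_mat n n"
    and "\<And>i j. \<lbrakk>i < n; j < n\<rbrakk> \<Longrightarrow> A $$ (i, j) \<in> carrier R"
    and "\<And>i j. \<lbrakk>i < n; j < i\<rbrakk> \<Longrightarrow> A $$ (i, j) = \<zero>"
    and "\<And>i j. \<lbrakk>i < n; j < n\<rbrakk> \<Longrightarrow> A $$ (i, i) = A $$ (j, j)"
  shows "A \<in> carrier (D n)"
  by (intro D_carrier_iff[THEN iffD2] conjI allI impI assms)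

lemma D_entry_closed [simp, intro]:
  "\<lbrakk>A \<in> carrier (D n); i < n; j < n\<rbrakk> \<Longrightarrow> A $$ (i, j) \<in> carrier R"
  by (rule D_carrier_iff[THEN iffD1, THEN conjunct2, THEN conjunct1, rule_format])

lemma D_entry_lower: "\<lbrakk>A \<in> carrier (D n); i < n; j < i\<rbrakk> \<Longrightarrow> A $$ (i, j) = \<zero>"
  by (rule D_carrier_iff[THEN iffD1, THEN conjunct2, THEN conjunct2, THEN conjunct1, rule_format])

lemma D_entry_diag: "\<lbrakk>A \<in> carrier (D n); i < n; j < n\<rbrakk> \<Longrightarrow> A $$ (i, i) = A $$ (j, j)"
  by (rule D_carrier_iff[THEN iffD1, THEN conjunct2, THEN conjunct2, THEN conjunct2, rule_format])

lemma D_mem_carrier_mat [simp]: "A \<in> carrier (D n) \<Longrightarrow> A \<in> carrier_mat n n"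
  by (rule D_carrier_iff[THEN iffD1, THEN conjunct1])

lemma D_eqI:
  assumes "A \<in> carrier_mat n n" "B \<in> carrier_mat n n"
    and "\<And>i j. \<lbrakk>i < n; j < n\<rbrakk> \<Longrightarrow> A $$ (i, j) = B $$ (i, j)"
  shows "A = B"
  using assms by (intro eq_matI) auto

lemma D_mult_diag:
  assumes "A \<in> carrier (D n)" "B \<in> carrier (D n)" "i < n"
  shows "(A \<otimes>\<^bsub>D n\<^esub> B) $$ (i, i) = A $$ (i, i) \<otimes> B $$ (i, i)"
proof -
  have "A $$ (i, k) \<otimes> B $$ (k, i) = \<zero>" if "k < n" "k \<noteq> i" for k
    using that assms by (cases "k < i") (simp_all add: D_entry_lower)
  then show ?thesis
    using assms finsum_eq_single[of "{..<n}" i "\<lambda>k. A $$ (i, k) \<otimes> B $$ (k, i)"] by simp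
qed

text \<open>Offsets from the diagonal add up, because a nonzero term \<open>A\<^sub>i\<^sub>k B\<^sub>k\<^sub>j\<close> requires \<open>k \<ge> i + p\<close> and
  \<open>j \<ge> k + q\<close>. Offsets \<open>0\<close> give closure under multiplication; offset \<open>1\<close> of the second factor makes
  powers of a strictly upper triangular matrix move away from the diagonal.\<close>

lemma D_mult_entry_zero:
  assumes "A \<in> carrier (D n)" "B \<in> carrier (D n)"
    and A: "\<And>i j. \<lbrakk>i < n; j < n; j < i + p\<rbrakk> \<Longrightarrow> A $$ (i, j) = \<zero>"
    and B: "\<And>i j. \<lbrakk>i < n; j < n; j < i + q\<rbrakk> \<Longrightarrow> B $$ (i, j) = \<zero>"
    and ij: "i < n" "j < n" "j < i + (p + q)"
  shows "(A \<otimes>\<^bsub>D n\<^esub> B) $$ (i, j) = \<zero>"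
proof -
  have "A $$ (i, k) \<otimes> B $$ (k, j) = \<zero>" if "k < n" for k
    using that assms(1,2) ij A[of i k] B[of k j] by (cases "k < i + p") auto
  then have "(\<Oplus>k\<in>{..<n}. A $$ (i, k) \<otimes> B $$ (k, j)) = (\<Oplus>k\<in>{..<n}. \<zero>)"
    by (intro finsum_cong') auto
  then show ?thesis using ij by simp
qed

lemma D_mult_closed:
  assumes "A \<in> carrier (D n)" "B \<in> carrier (D n)"
  shows "A \<otimes>\<^bsub>D n\<^esub> B \<in> carrier (D n)"
proof (rule D_carrierI)
  show "(A \<otimes>\<^bsub>D n\<^esub> B) $$ (i, j) = \<zero>" if "i < n" "j < i" for i j
    by (rule D_mult_entry_zero[OF assms, where p = 0 and q = 0])
      (use that assms in \<open>simp_all add: D_entry_lower\<close>)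
  show "(A \<otimes>\<^bsub>D n\<^esub> B) $$ (i, i) = (A \<otimes>\<^bsub>D n\<^esub> B) $$ (j, j)" if "i < n" "j < n" for i j
    using D_entry_diag[OF assms(1) that] D_entry_diag[OF assms(2) that]
    by (simp only: D_mult_diag assms that)
  show "(A \<otimes>\<^bsub>D n\<^esub> B) $$ (i, j) \<in> carrier R" if "i < n" "j < n" for i j
    using that assms by (auto intro!: finsum_closed)
qed simp

lemma D_mult_assoc:
  assumes "A \<in> carrier (D n)" "B \<in> carrier (D n)" "C \<in> carrier (D n)"
  shows "(A \<otimes>\<^bsub>D n\<^esub> B) \<otimes>\<^bsub>D n\<^esub> C = A \<otimes>\<^bsub>D n\<^esub> (B \<otimes>\<^bsub>D n\<^esub> C)"
proof (rule D_eqI[of _ n])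
  fix i j assume ij: "i < n" "j < n"
  have "((A \<otimes>\<^bsub>D n\<^esub> B) \<otimes>\<^bsub>D n\<^esub> C) $$ (i, j)
      = (\<Oplus>k\<in>{..<n}. (\<Oplus>l\<in>{..<n}. A $$ (i, l) \<otimes> B $$ (l, k)) \<otimes> C $$ (k, j))"
    using ij assms by (simp cong: finsum_cong)
  also have "\<dots> = (\<Oplus>k\<in>{..<n}. \<Oplus>l\<in>{..<n}. A $$ (i, l) \<otimes> (B $$ (l, k) \<otimes> C $$ (k, j)))"
  proof (intro finsum_cong' refl)
    fix k assume "k \<in> {..<n}"
    then show "(\<Oplus>l\<in>{..<n}. A $$ (i, l) \<otimes> B $$ (l, k)) \<otimes> C $$ (k, j)
      = (\<Oplus>l\<in>{..<n}. A $$ (i, l) \<otimes> (B $$ (l, k) \<otimes> C $$ (k, j)))"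
      using ij assms by (subst finsum_ldistr) (auto intro!: finsum_cong' simp: m_assoc)
  qed (use ij assms in \<open>auto intro!: finsum_closed\<close>)
  also have "\<dots> = (\<Oplus>l\<in>{..<n}. \<Oplus>k\<in>{..<n}. A $$ (i, l) \<otimes> (B $$ (l, k) \<otimes> C $$ (k, j)))"
    using ij assms by (intro finsum_finsum_swap) auto
  also have "\<dots> = (\<Oplus>l\<in>{..<n}. A $$ (i, l) \<otimes> (\<Oplus>k\<in>{..<n}. B $$ (l, k) \<otimes> C $$ (k, j)))"
  proof (intro finsum_cong' refl)
    fix l assume "l \<in> {..<n}"
    then show "(\<Oplus>k\<in>{..<n}. A $$ (i, l) \<otimes> (B $$ (l, k) \<otimes> C $$ (k, j)))
      = A $$ (i, l) \<otimes> (\<Oplus>k\<in>{..<n}. B $$ (l, k) \<otimes> C $$ (k, j))"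
      using ij assms by (subst finsum_rdistr) auto
  qed (use ij assms in \<open>auto intro!: finsum_closed\<close>)
  also have "\<dots> = (A \<otimes>\<^bsub>D n\<^esub> (B \<otimes>\<^bsub>D n\<^esub> C)) $$ (i, j)"
    using ij assms by (simp cong: finsum_cong)
  finally show "((A \<otimes>\<^bsub>D n\<^esub> B) \<otimes>\<^bsub>D n\<^esub> C) $$ (i, j) = (A \<otimes>\<^bsub>D n\<^esub> (B \<otimes>\<^bsub>D n\<^esub> C)) $$ (i, j)" .
qed simp_all

lemma D_add_closed:
  assumes "A \<in> carrier (D n)" "B \<in> carrier (D n)"
  shows "A \<oplus>\<^bsub>D n\<^esub> B \<in> carrier (D n)"
proof (rule D_carrierI)
  show "(A \<oplus>\<^bsub>D n\<^esub> B) $$ (i, i) = (A \<oplus>\<^bsub>D n\<^esub> B) $$ (j, j)" if "i < n" "j < n" for i j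
    using that D_entry_diag[OF assms(1) that] D_entry_diag[OF assms(2) that] by simp
qed (use assms in \<open>simp_all add: D_entry_lower\<close>)

definition scalar_matrix :: "nat \<Rightarrow> 'a \<Rightarrow> 'a mat" where
  "scalar_matrix n r = mat n n (\<lambda>(i, j). if i = j then r else \<zero>)"

lemma scalar_matrix_index [simp]:
  "\<lbrakk>i < n; j < n\<rbrakk> \<Longrightarrow> scalar_matrix n r $$ (i, j) = (if i = j then r else \<zero>)"
  by (simp add: scalar_matrix_def)

lemma scalar_matrix_closed: "r \<in> carrier R \<Longrightarrow> scalar_matrix n r \<in> carrier (D n)"
  by (rule D_carrierI) (simp_all add: scalar_matrix_def)

lemma D_one_eq: "\<one>\<^bsub>D n\<^esub> = scalar_matrix n \<one>"
  and D_zero_eq: "\<zero>\<^bsub>D n\<^esub> = scalar_matrix n \<zero>"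
  by (auto intro!: D_eqI[of _ n] simp: scalar_matrix_def)

lemma scalar_matrix_mult_index:
  assumes "A \<in> carrier (D n)" "r \<in> carrier R" "i < n" "j < n"
  shows "(scalar_matrix n r \<otimes>\<^bsub>D n\<^esub> A) $$ (i, j) = r \<otimes> A $$ (i, j)"
  using assms
    finsum_eq_single[of "{..<n}" i "\<lambda>k. scalar_matrix n r $$ (i, k) \<otimes> A $$ (k, j)"] by simp

lemma mult_scalar_matrix_index:
  assumes "A \<in> carrier (D n)" "r \<in> carrier R" "i < n" "j < n"
  shows "(A \<otimes>\<^bsub>D n\<^esub> scalar_matrix n r) $$ (i, j) = A $$ (i, j) \<otimes> r"
  using assms
    finsum_eq_single[of "{..<n}" j "\<lambda>k. A $$ (i, k) \<otimes> scalar_matrix n r $$ (k, j)"] by simp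

lemma scalar_matrix_mult:
  assumes "r \<in> carrier R" "t \<in> carrier R"
  shows "scalar_matrix n (r \<otimes> t) = scalar_matrix n r \<otimes>\<^bsub>D n\<^esub> scalar_matrix n t"
proof (rule D_eqI[of _ n])
  show "scalar_matrix n (r \<otimes> t) $$ (i, j) = (scalar_matrix n r \<otimes>\<^bsub>D n\<^esub> scalar_matrix n t) $$ (i, j)"
    if "i < n" "j < n" for i j
    using that assms scalar_matrix_mult_index[of "scalar_matrix n t" n r i j]
    by (simp add: scalar_matrix_closed del: D_index)
qed (use assms in \<open>simp_all add: scalar_matrix_closed\<close>)

lemma D_abelian_group: "abelian_group (D n)"
proof (rule abelian_groupI)
  fix A assume A: "A \<in> carrier (D n)"
  define B where "B = mat n n (\<lambda>ij. \<ominus> (A $$ ij))"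
  have "B \<in> carrier (D n)"
  proof (rule D_carrierI)
    show "B $$ (i, i) = B $$ (j, j)" if "i < n" "j < n" for i j
      using that D_entry_diag[OF A that] by (simp add: B_def)
  qed (use A in \<open>simp_all add: B_def D_entry_lower\<close>)
  moreover have "B \<oplus>\<^bsub>D n\<^esub> A = \<zero>\<^bsub>D n\<^esub>"
    using A by (intro D_eqI[of _ n]) (simp_all add: B_def l_neg)
  ultimately show "\<exists>B\<in>carrier (D n). B \<oplus>\<^bsub>D n\<^esub> A = \<zero>\<^bsub>D n\<^esub>" by blast
next
  show "\<zero>\<^bsub>D n\<^esub> \<in> carrier (D n)" by (simp add: D_zero_eq scalar_matrix_closed)
next
  fix A B C assume "A \<in> carrier (D n)" "B \<in> carrier (D n)" "C \<in> carrier (D n)"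
  then show "(A \<oplus>\<^bsub>D n\<^esub> B) \<oplus>\<^bsub>D n\<^esub> C = A \<oplus>\<^bsub>D n\<^esub> (B \<oplus>\<^bsub>D n\<^esub> C)"
    by (intro D_eqI[of _ n]) (simp_all add: a_assoc)
next
  fix A B assume "A \<in> carrier (D n)" "B \<in> carrier (D n)"
  then show "A \<oplus>\<^bsub>D n\<^esub> B = B \<oplus>\<^bsub>D n\<^esub> A"
    by (intro D_eqI[of _ n]) (simp_all add: a_comm)
next
  fix A assume "A \<in> carrier (D n)"
  then show "\<zero>\<^bsub>D n\<^esub> \<oplus>\<^bsub>D n\<^esub> A = A" by (intro D_eqI[of _ n]) simp_all
qed (rule D_add_closed)

lemma D_monoid: "monoid (D n)"
proof (rule monoidI)
  show "\<one>\<^bsub>D n\<^esub> \<in> carrier (D n)" by (simp add: D_one_eq scalar_matrix_closed)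
next
  fix A assume "A \<in> carrier (D n)"
  then show "\<one>\<^bsub>D n\<^esub> \<otimes>\<^bsub>D n\<^esub> A = A" "A \<otimes>\<^bsub>D n\<^esub> \<one>\<^bsub>D n\<^esub> = A"
    unfolding D_one_eq
    by (auto intro!: D_eqI[of _ n]
        simp: scalar_matrix_mult_index mult_scalar_matrix_index simp del: D_index)
qed (use D_mult_closed D_mult_assoc in auto)

lemma D_ring: "ring (D n)"
proof (rule ringI)
  fix A B C assume ABC: "A \<in> carrier (D n)" "B \<in> carrier (D n)" "C \<in> carrier (D n)"
  show "(A \<oplus>\<^bsub>D n\<^esub> B) \<otimes>\<^bsub>D n\<^esub> C = A \<otimes>\<^bsub>D n\<^esub> C \<oplus>\<^bsub>D n\<^esub> B \<otimes>\<^bsub>D n\<^esub> C"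
  proof (rule D_eqI[of _ n])
    fix i j assume ij: "i < n" "j < n"
    have "((A \<oplus>\<^bsub>D n\<^esub> B) \<otimes>\<^bsub>D n\<^esub> C) $$ (i, j)
      = (\<Oplus>k\<in>{..<n}. A $$ (i, k) \<otimes> C $$ (k, j) \<oplus> B $$ (i, k) \<otimes> C $$ (k, j))"
      unfolding D_index(1)[OF ij] using ij ABC by (intro finsum_cong') (auto simp: l_distr)
    also have "\<dots> = (A \<otimes>\<^bsub>D n\<^esub> C \<oplus>\<^bsub>D n\<^esub> B \<otimes>\<^bsub>D n\<^esub> C) $$ (i, j)"
      using ij ABC by simp
    finally show "((A \<oplus>\<^bsub>D n\<^esub> B) \<otimes>\<^bsub>D n\<^esub> C) $$ (i, j) = \<dots>" .
  qed simp_all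
  show "C \<otimes>\<^bsub>D n\<^esub> (A \<oplus>\<^bsub>D n\<^esub> B) = C \<otimes>\<^bsub>D n\<^esub> A \<oplus>\<^bsub>D n\<^esub> C \<otimes>\<^bsub>D n\<^esub> B"
  proof (rule D_eqI[of _ n])
    fix i j assume ij: "i < n" "j < n"
    have "(C \<otimes>\<^bsub>D n\<^esub> (A \<oplus>\<^bsub>D n\<^esub> B)) $$ (i, j)
      = (\<Oplus>k\<in>{..<n}. C $$ (i, k) \<otimes> A $$ (k, j) \<oplus> C $$ (i, k) \<otimes> B $$ (k, j))"
      unfolding D_index(1)[OF ij] using ij ABC by (intro finsum_cong') (auto simp: r_distr)
    also have "\<dots> = (C \<otimes>\<^bsub>D n\<^esub> A \<oplus>\<^bsub>D n\<^esub> C \<otimes>\<^bsub>D n\<^esub> B) $$ (i, j)"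
      using ij ABC by simp
    finally show "(C \<otimes>\<^bsub>D n\<^esub> (A \<oplus>\<^bsub>D n\<^esub> B)) $$ (i, j) = \<dots>" .
  qed simp_all
qed (rule D_abelian_group D_monoid)+

lemma strictly_upper_nilpotent:
  assumes A: "A \<in> carrier (D n)" and diag: "A $$ (0, 0) = \<zero>"
  shows "A [^]\<^bsub>D n\<^esub> n = \<zero>\<^bsub>D n\<^esub>"
proof -
  interpret D: ring "D n" by (rule D_ring)
  have A0: "A $$ (i, j) = \<zero>" if "i < n" "j < n" "j < i + 1" for i j
    using that A D_entry_diag[of A n i 0] diag by (cases "i = j") (auto simp: D_entry_lower)
  have "(A [^]\<^bsub>D n\<^esub> k) $$ (i, j) = \<zero>" if "i < n" "j < n" "j < i + k" for i j k
    using that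
  proof (induction k arbitrary: i j)
    case 0
    then show ?case by simp
  next
    case (Suc k)
    have "(A [^]\<^bsub>D n\<^esub> k \<otimes>\<^bsub>D n\<^esub> A) $$ (i, j) = \<zero>"
      using Suc.prems by (intro D_mult_entry_zero[where p = k and q = 1] Suc.IH A0 A) (use A in auto)
    then show ?case by (simp del: D_index)
  qed
  then show ?thesis using D.nat_pow_closed[OF A, of n] by (intro D_eqI[of _ n]) auto
qed

lemma diagonal_nil_epimorphism:
  assumes "n \<ge> 1"
  shows "nil_epimorphism (D n) R (\<lambda>A. A $$ (0, 0))"
proof (intro nil_epimorphism.intro nil_epimorphism_axioms.intro)
  show "ring_hom_ring (D n) R (\<lambda>A. A $$ (0, 0))"
    using assms
    by (intro ring_hom_ringI D_ring ring_axioms) (auto simp: D_mult_diag simp del: D_index(1))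
  show "\<exists>A\<in>carrier (D n). A $$ (0, 0) = r" if "r \<in> carrier R" for r
    using that assms by (intro bexI[OF _ scalar_matrix_closed[of r]]) auto
qed (use strictly_upper_nilpotent in blast)

end

theorem lemma5p3:
  fixes R :: "('a, 'm) ring_scheme" and n :: nat
  assumes "nontrivial_ring R" and "n \<ge> 1"
  shows "sqrtJ_clean_ring R \<longleftrightarrow> sqrtJ_clean_ring (diag_const_upper_ring n R)"
proof -
  interpret R: nontrivial_ring R by fact
  note epi = R.diagonal_nil_epimorphism[OF assms(2)]
  have nontrivial: "nontrivial_ring (R.D n)"
  proof (intro nontrivial_ring.intro nontrivial_ring_axioms.intro R.D_ring notI)
    assume "\<one>\<^bsub>R.D n\<^esub> = \<zero>\<^bsub>R.D n\<^esub>"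
    then have "\<one>\<^bsub>R.D n\<^esub> $$ (0, 0) = \<zero>\<^bsub>R.D n\<^esub> $$ (0, 0)" by simp
    then show False using assms(2) R.one_not_zero by simp
  qed
  show ?thesis
  proof
    assume "sqrtJ_clean_ring R"
    then show "sqrtJ_clean_ring (R.D n)"
      by (rule nil_epimorphism.sqrtJ_clean_lift[OF epi _ nontrivial, where s = "R.scalar_matrix n"])
        (use assms(2) in \<open>auto simp: R.scalar_matrix_closed R.scalar_matrix_mult\<close>)
  next
    assume "sqrtJ_clean_ring (R.D n)"
    then show "sqrtJ_clean_ring R" by (rule nil_epimorphism.sqrtJ_clean_image[OF epi _ assms(1)])
  qed
qed

end
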